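(* Let $n\geq 4$ and let $f(x,y)$ be a symmetric real function with the property $P^*$. Let $G$ be any bicyclic graph on $n$ vertices. Then $\rho(A_f(G))\leq \rho(A_f(G_1))$, with equality if and only if $G\cong G_1$, where $G_1$ is the graph on $n$ vertices obtained from $K_4$ minus an edge (the graph on vertices $x,y,v,w$ with edges $xy,xv,xw,yv,yw$) by attaching $n-4$ pendant vertices to the vertex $x$ (a vertex of degree $3$).
   Context: All graphs are finite, simple and connected. A bicyclic graph on $n$ vertices is a connected simple graph with $n$ vertices and $n+1$ edges. For a graph $G$ with vertex set $\{1,\dots,n\}$ and vertex degrees $d_i$, the weighted adjacency matrix $A_f(G)=[a_{ij}]$ is the $n\times n$ matrix with $a_{ij}=f(d_i,d_j)$ if $ij$ is an edge and $a_{ij}=0$ otherwise, where $f$ is a symmetric bivariate real function with $f(d_i,d_j)>0$ whenever $ij$ is an edge. $\rho(A_f(G))$ denotes the spectral radius of $A_f(G)$. A symmetric function $f(x,y)$ has property $P^*$ if (i) $f(x,y)$ is increasing in $x$; (ii) $f(x,y)$ is convex in $x$; and (iii) $f(x_1,y_1)\geq f(x_2,y_2)$ whenever $|x_1-y_1|>|x_2-y_2|$ and $x_1+y_1=x_2+y_2$. *)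

theory Defs
  imports
    "Graph_Theory.Graph_Theory"
    "Jordan_Normal_Form.Spectral_Radius"
    "HOL-Analysis.Convex"
begin

text \<open>
  A finite simple graph is a \<^locale>\<open>pair_graph\<close>: a finite, loop-free digraph without parallel arcs
  whose arc relation is symmetric. Each edge is present as two opposite arcs, so edges are counted
  as two-element vertex sets, and the degree of a vertex is its out-degree.
\<close>

definition edges_of :: "'a pair_pre_digraph \<Rightarrow> 'a set set" where
  "edges_of G = (\<lambda>(u, v). {u, v}) ` parcs G"

definition degree_of :: "'a pair_pre_digraph \<Rightarrow> 'a \<Rightarrow> nat" where
  "degree_of G v = out_degree (with_proj G) v"

definition bicyclic_graph :: "nat \<Rightarrow> 'a pair_pre_digraph \<Rightarrow> bool" where
  "bicyclic_graph n G \<longleftrightarrow>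
     pair_graph G \<and> Digraph_Component.connected (with_proj G) \<and>
     card (pverts G) = n \<and> card (edges_of G) = n + 1"

definition graph_iso :: "'a pair_pre_digraph \<Rightarrow> 'b pair_pre_digraph \<Rightarrow> bool" where
  "graph_iso G H \<longleftrightarrow> digraph_iso (with_proj G) (with_proj H)"

text \<open>
  Degrees are the only arguments ever supplied to a weight function, and in a connected graph with
  at least two vertices they are at least 1. Hence the conditions on a weight function are imposed
  for real arguments in \<open>[1, \<infinity>)\<close>; any larger domain gives stronger conditions.
  ``Increasing'' is meant in the weak sense, so that constant weights are included.
\<close>

definition symmetric_weight :: "(real \<Rightarrow> real \<Rightarrow> real) \<Rightarrow> bool" where
  "symmetric_weight f \<longleftrightarrow> (\<forall>x\<ge>1. \<forall>y\<ge>1. f x y = f y x)"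

definition property_P_star :: "(real \<Rightarrow> real \<Rightarrow> real) \<Rightarrow> bool" where
  "property_P_star f \<longleftrightarrow>
     (\<forall>y\<ge>1. mono_on {1..} (\<lambda>x. f x y)) \<and>
     (\<forall>y\<ge>1. convex_on {1..} (\<lambda>x. f x y)) \<and>
     (\<forall>x1\<ge>1. \<forall>y1\<ge>1. \<forall>x2\<ge>1. \<forall>y2\<ge>1.
        \<bar>x1 - y1\<bar> > \<bar>x2 - y2\<bar> \<and> x1 + y1 = x2 + y2 \<longrightarrow> f x1 y1 \<ge> f x2 y2)"

definition positive_on_edges :: "(real \<Rightarrow> real \<Rightarrow> real) \<Rightarrow> 'a pair_pre_digraph \<Rightarrow> bool" where
  "positive_on_edges f G \<longleftrightarrow>
     (\<forall>(u, v) \<in> parcs G. f (real (degree_of G u)) (real (degree_of G v)) > 0)"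

text \<open>The vertices of a graph with \<open>n\<close> vertices are taken to be \<open>0, \<dots>, n - 1\<close>,
  matching the zero-based matrix indices.\<close>

definition weighted_adj_mat ::
    "(real \<Rightarrow> real \<Rightarrow> real) \<Rightarrow> nat \<Rightarrow> nat pair_pre_digraph \<Rightarrow> real mat" where
  "weighted_adj_mat f n G =
     mat n n (\<lambda>(i, j). if (i, j) \<in> parcs G
                       then f (real (degree_of G i)) (real (degree_of G j)) else 0)"

definition spectral_radius_real :: "real mat \<Rightarrow> real" where
  "spectral_radius_real A = spectral_radius (map_mat complex_of_real A)"

text \<open>The vertices \<open>x, y, v, w\<close> of \<open>K\<^sub>4\<close> minus the edge \<open>vw\<close> are \<open>0, 1, 2, 3\<close>;
  the pendant vertices attached to \<open>x\<close> are \<open>4, \<dots>, n - 1\<close>.\<close>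

definition G1_half :: "nat \<Rightarrow> (nat \<times> nat) set" where
  "G1_half n = {(0, 1), (0, 2), (0, 3), (1, 2), (1, 3)} \<union> {0} \<times> {4..<n}"

definition G1 :: "nat \<Rightarrow> nat pair_pre_digraph" where
  "G1 n = \<lparr> pverts = {0..<n}, parcs = G1_half n \<union> (G1_half n)\<inverse> \<rparr>"

end

theory Submission
  imports Defs "HOL-Analysis.Function_Topology"
begin

text \<open>
  Let \<open>u\<close> and \<open>v\<close> be vertices, adjacent or with a common neighbour, each having a neighbour that is
  neither the other vertex nor adjacent to it. Let \<open>x\<close> be a Perron vector with \<open>x u \<ge> x v\<close>. The
  Kelmans transformation, which moves all private neighbours of \<open>v\<close> to \<open>u\<close>, does not decrease the
  quadratic form at \<open>x\<close>: monotonicity handles the private neighbours, convexity the common ones, and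
  condition (iii) the possible edge \<open>uv\<close>. If the radius did not increase, \<open>x\<close> would remain an
  eigenvector for the same eigenvalue, which fails in row \<open>u\<close> when all weights of the original
  edges are positive.

  A connected graph that admits no such transformation has a dominating vertex, namely any vertex
  of maximum degree. In the bicyclic case two edges remain besides those at the dominating vertex; were
  they disjoint, a transformation would apply, so they share a vertex and the graph is the one
  claimed.
\<close>

section \<open>Spectral radius of nonnegative symmetric matrices\<close>

definition quad_form :: "nat \<Rightarrow> (nat \<Rightarrow> nat \<Rightarrow> real) \<Rightarrow> (nat \<Rightarrow> real) \<Rightarrow> real" where
  "quad_form n a x = (\<Sum>i<n. \<Sum>j<n. a i j * x i * x j)"

text \<open>Compactness of the unit sphere yields a maximiser \<open>x\<close>, and \<open>R\<close>
  is the maximum there. The bound for an arbitrary \<open>y\<close> follows by homogeneity of degree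
  two.\<close>

lemma quad_form_attains_max:
  assumes "n > 0"
  obtains x R where "(\<Sum>i<n. (x i)\<^sup>2) = 1" "quad_form n a x = R"
    "\<And>y. quad_form n a y \<le> R * (\<Sum>i<n. (y i)\<^sup>2)"
proof -
  \<comment> \<open>Vectors are functions on all naturals. Pinning the coordinates from
    \<open>n\<close> on to 0 and confining the others to \<open>{-1..1}\<close> gives a product of
    compact sets, so Tychonoff's theorem applies.\<close>
  define P where "P = PiE (UNIV :: nat set) (\<lambda>i. if i < n then {-1..1::real} else {0})"
  define K where "K = P \<inter> {x. (\<Sum>i<n. (x i)\<^sup>2) = 1}"
  have "compactin (product_topology (\<lambda>_. euclidean) UNIV) P"
    unfolding P_def by (subst compactin_PiE) auto
  then have "compact P"
    by (simp add: euclidean_product_topology)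
  have coord: "continuous_on S (\<lambda>x :: nat \<Rightarrow> real. x i)" for i S
    by (rule continuous_on_subset[OF continuous_on_product_coordinates]) simp
  have "closed {x :: nat \<Rightarrow> real. (\<Sum>i<n. (x i)\<^sup>2) = 1}"
    by (intro closed_Collect_eq continuous_on_sum continuous_on_power coord continuous_on_const)
  then have "compact K"
    unfolding K_def using \<open>compact P\<close> by blast
  moreover have "(\<lambda>i. if i = 0 then 1 else 0) \<in> K"
    using assms by (auto simp: K_def P_def if_distrib[of "\<lambda>t. t\<^sup>2"] cong: if_cong)
  moreover have "continuous_on K (quad_form n a)"
    unfolding quad_form_def by (intro continuous_on_sum continuous_on_mult coord continuous_on_const)
  ultimately obtain x where x: "x \<in> K" and max: "\<And>y. y \<in> K \<Longrightarrow> quad_form n a y \<le> quad_form n a x"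
    using continuous_attains_sup[of K "quad_form n a"] by auto
  have "quad_form n a y \<le> quad_form n a x * (\<Sum>i<n. (y i)\<^sup>2)" for y
  proof (cases "(\<Sum>i<n. (y i)\<^sup>2) = 0")
    case True
    then have "\<forall>i<n. y i = 0"
      by (simp add: sum_nonneg_eq_0_iff)
    then show ?thesis
      by (simp add: quad_form_def)
  next
    case False
    define s where "s = (\<Sum>i<n. (y i)\<^sup>2)"
    have s: "s > 0"
      using False by (simp add: s_def order_less_le sum_nonneg)
    define z where "z = (\<lambda>i. if i < n then y i / sqrt s else 0)"
    have "(z i)\<^sup>2 = (y i)\<^sup>2 / s" if "i < n" for i
      using that s by (simp add: z_def power_divide)
    then have zs: "(\<Sum>i<n. (z i)\<^sup>2) = 1"
      using s by (simp add: s_def flip: sum_divide_distrib)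
    have "(z i)\<^sup>2 \<le> 1" if "i < n" for i
      unfolding zs[symmetric] by (rule member_le_sum) (use that in auto)
    then have "- 1 \<le> z i \<and> z i \<le> 1" if "i < n" for i
      using that by (simp only: abs_square_le_1 abs_le_iff) (metis minus_le_iff)
    moreover have "z i = 0" if "\<not> i < n" for i
      using that by (simp add: z_def)
    ultimately have "z \<in> K"
      using zs by (auto simp: K_def P_def)
    then have "quad_form n a z \<le> quad_form n a x"
      by (rule max)
    moreover have "quad_form n a y = s * quad_form n a z"
      using s by (simp add: quad_form_def z_def sum_distrib_left flip: power2_eq_square)
    ultimately show ?thesis
      using s by (simp add: s_def[symmetric] mult.commute)
  qed
  then show ?thesis
    using that x by (auto simp: K_def)
qed

text \<open>Symmetry of \<open>a\<close> merges the two cross terms, so the coefficient of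
  \<open>t\<close> is twice the pairing of \<open>y\<close> with the image of
  \<open>x\<close>.\<close>

lemma quad_form_add_scaled:
  assumes "\<And>i j. i < n \<Longrightarrow> j < n \<Longrightarrow> a i j = a j i"
  shows "quad_form n a (\<lambda>i. x i + t * y i) =
    quad_form n a x + 2 * t * (\<Sum>i<n. y i * (\<Sum>j<n. a i j * x j)) + t\<^sup>2 * quad_form n a y"
proof -
  have sw: "(\<Sum>i<n. \<Sum>j<n. a i j * x i * y j) = (\<Sum>i<n. \<Sum>j<n. a i j * y i * x j)"
    by (subst sum.swap) (intro sum.cong refl, simp add: assms mult.commute mult.left_commute)
  have "quad_form n a (\<lambda>i. x i + t * y i) = quad_form n a x + t * (\<Sum>i<n. \<Sum>j<n. a i j * x i * y j)
     + t * (\<Sum>i<n. \<Sum>j<n. a i j * y i * x j) + t\<^sup>2 * quad_form n a y"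
    unfolding quad_form_def
    by (simp add: sum_distrib_left algebra_simps sum.distrib power2_eq_square)
  also have "\<dots> = quad_form n a x + 2 * t * (\<Sum>i<n. \<Sum>j<n. a i j * y i * x j) + t\<^sup>2 * quad_form n a y"
    by (simp add: sw)
  also have "(\<Sum>i<n. \<Sum>j<n. a i j * y i * x j) = (\<Sum>i<n. y i * (\<Sum>j<n. a i j * x j))"
    by (simp add: sum_distrib_left algebra_simps)
  finally show ?thesis .
qed

lemma linear_coeff_eq_0_if_quadratic_nonpos:
  fixes b c :: real
  assumes "\<And>t. b * t + c * t\<^sup>2 \<le> 0"
  shows "b = 0"
proof (rule ccontr)
  assume "b \<noteq> 0"
  \<comment> \<open>With this \<open>t\<close> the quadratic equals
    \<open>t * t * (\<bar>c\<bar> + 1 + c)\<close>, which is positive whatever the sign of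
    \<open>c\<close>.\<close>
  define t where "t = b / (\<bar>c\<bar> + 1)"
  have b: "b = t * (\<bar>c\<bar> + 1)"
    by (simp add: t_def)
  then have "b * t + c * t\<^sup>2 = t\<^sup>2 * (\<bar>c\<bar> + 1 + c)"
    by (simp add: algebra_simps power2_eq_square)
  moreover have "\<dots> > 0"
    using \<open>b \<noteq> 0\<close> b by (intro mult_pos_pos) auto
  ultimately show False
    using assms[of t] by linarith
qed

text \<open>First variation: along the \<open>k\<close>-th unit vector the defect
  \<open>quad_form - R * norm\<close> is nonpositive and vanishes at \<open>x\<close>, so its linear
  coefficient, a multiple of row \<open>k\<close> of the eigenvalue equation, is zero.\<close>

lemma quad_form_maximizer_eigenvector:
  assumes sym: "\<And>i j. i < n \<Longrightarrow> j < n \<Longrightarrow> a i j = a j i"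
    and bound: "\<And>y. quad_form n a y \<le> R * (\<Sum>i<n. (y i)\<^sup>2)"
    and eq: "quad_form n a x = R * (\<Sum>i<n. (x i)\<^sup>2)"
    and k: "k < n"
  shows "(\<Sum>j<n. a k j * x j) = R * x k"
proof -
  define y where "y = (\<lambda>i. if i = k then 1 else 0 :: real)"
  have y: "(\<Sum>i<n. y i * g i) = g k" for g
    using k by (simp add: y_def if_distrib[of "\<lambda>t. t * _"] cong: if_cong)
  have "2 * ((\<Sum>j<n. a k j * x j) - R * x k) * t + (quad_form n a y - R) * t\<^sup>2 \<le> 0" for t
  proof -
    have "(\<Sum>i<n. (x i + t * y i)\<^sup>2) = (\<Sum>i<n. (x i)\<^sup>2) + 2 * t * (\<Sum>i<n. y i * x i) + t\<^sup>2 * (\<Sum>i<n. y i * y i)"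
      by (simp add: sum_distrib_left algebra_simps sum.distrib power2_eq_square)
    also have "\<dots> = (\<Sum>i<n. (x i)\<^sup>2) + 2 * t * x k + t\<^sup>2"
      unfolding y by (simp add: y_def)
    finally have "quad_form n a (\<lambda>i. x i + t * y i) \<le> R * ((\<Sum>i<n. (x i)\<^sup>2) + 2 * t * x k + t\<^sup>2)"
      using bound[of "\<lambda>i. x i + t * y i"] by simp
    moreover have "quad_form n a (\<lambda>i. x i + t * y i) =
        R * (\<Sum>i<n. (x i)\<^sup>2) + 2 * t * (\<Sum>j<n. a k j * x j) + t\<^sup>2 * quad_form n a y"
      using quad_form_add_scaled[of n a x t y] sym y[of "\<lambda>i. \<Sum>j<n. a i j * x j"] eq by simp
    ultimately show ?thesis
      by (simp only: algebra_simps)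
  qed
  then show ?thesis
    using linear_coeff_eq_0_if_quadratic_nonpos by fastforce
qed

text \<open>Entries are given by a function, so that the estimates can be carried out with plain
  sums; the matrix type appears only in the link to the spectrum.\<close>

definition sradius :: "nat \<Rightarrow> (nat \<Rightarrow> nat \<Rightarrow> real) \<Rightarrow> real" where
  "sradius n a = spectral_radius_real (mat n n (\<lambda>(i, j). a i j))"

lemma real_eigenvalue_le_sradius:
  assumes "\<And>i. i < n \<Longrightarrow> (\<Sum>j<n. a i j * x j) = R * x i"
    and "k < n" "x k \<noteq> 0"
  shows "R \<le> sradius n a"
proof -
  let ?A = "map_mat complex_of_real (mat n n (\<lambda>(i, j). a i j))"
  let ?v = "vec n (\<lambda>i. complex_of_real (x i))"
  have "(\<Sum>j<n. complex_of_real (a i j) * complex_of_real (x j)) = complex_of_real R * complex_of_real (x i)"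
    if "i < n" for i
    using arg_cong[OF assms(1)[OF that], of complex_of_real] by simp
  then have "?A *\<^sub>v ?v = complex_of_real R \<cdot>\<^sub>v ?v"
    by (intro eq_vecI) (auto simp: scalar_prod_def atLeast0LessThan)
  moreover have "?v \<noteq> 0\<^sub>v n"
    using assms(2,3) by (auto dest!: arg_cong[of _ _ "\<lambda>v. v $ k"])
  ultimately have "complex_of_real R \<in> spectrum ?A"
    unfolding spectrum_def eigenvalue_def eigenvector_def by (auto intro!: exI[of _ ?v])
  then have "\<bar>R\<bar> \<le> spectral_radius ?A"
    using spectral_radius_mem_max(2)[of ?A n "\<bar>R\<bar>"] assms(2)
    by (metis (no_types, lifting) dim_col_mat(1) dim_row_mat(1) carrier_matI gr_implies_not0 imageI
        index_map_mat(2,3) neq0_conv norm_of_real)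
  then show ?thesis
    by (simp add: sradius_def spectral_radius_real_def)
qed

text \<open>The spectrum is that of a complex matrix, so the eigenvalue of largest modulus and its
  eigenvector are only known to be complex.\<close>

lemma sradius_eigenvector:
  assumes "n > 0"
  obtains w :: "nat \<Rightarrow> complex" and \<mu> k where "k < n" "w k \<noteq> 0" "norm \<mu> = sradius n a"
    "\<And>i. i < n \<Longrightarrow> (\<Sum>j<n. complex_of_real (a i j) * w j) = \<mu> * w i"
proof -
  let ?A = "map_mat complex_of_real (mat n n (\<lambda>(i, j). a i j))"
  have "sradius n a \<in> norm ` spectrum ?A"
    unfolding sradius_def spectral_radius_real_def
    by (rule spectral_radius_mem_max(1)[of _ n]) (use assms in auto)
  then obtain \<mu> v where \<mu>: "norm \<mu> = sradius n a" and v: "v \<in> carrier_vec n" "v \<noteq> 0\<^sub>v n" "?A *\<^sub>v v = \<mu> \<cdot>\<^sub>v v"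
    by (auto simp: spectrum_def eigenvalue_def eigenvector_def)
  have "(\<Sum>j<n. complex_of_real (a i j) * v $ j) = \<mu> * v $ i" if "i < n" for i
    using arg_cong[OF v(3), of "\<lambda>u. u $ i"] that v(1)
    by (auto simp: scalar_prod_def atLeast0LessThan)
  moreover obtain k where "k < n" "v $ k \<noteq> 0"
    using v(1,2) by (metis carrier_vecD eq_vecI index_zero_vec(1) index_zero_vec(2))
  ultimately show ?thesis
    using that \<mu> by blast
qed

lemma quad_form_abs_mono:
  assumes "\<And>i j. i < n \<Longrightarrow> j < n \<Longrightarrow> a i j \<ge> 0"
  shows "quad_form n a x \<le> quad_form n a (\<lambda>i. \<bar>x i\<bar>)"
  unfolding quad_form_def
proof (intro sum_mono)
  fix i j assume "i \<in> {..<n}" "j \<in> {..<n}"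
  then have "a i j * (x i * x j) \<le> a i j * \<bar>x i * x j\<bar>"
    using assms by (intro mult_left_mono) auto
  then show "a i j * x i * x j \<le> a i j * \<bar>x i\<bar> * \<bar>x j\<bar>"
    by (simp add: abs_mult mult.assoc)
qed

text \<open>The maximum \<open>R\<close> of the Rayleigh quotient is the spectral radius. Passing to
  absolute values keeps a maximiser maximal, because the entries are nonnegative; this gives a
  nonnegative eigenvector for \<open>R\<close>.\<close>

theorem sradius_symmetric_nonneg:
  assumes n: "n > 0"
    and sym: "\<And>i j. i < n \<Longrightarrow> j < n \<Longrightarrow> a i j = a j i"
    and nonneg: "\<And>i j. i < n \<Longrightarrow> j < n \<Longrightarrow> a i j \<ge> 0"
  shows quad_form_le_sradius: "quad_form n a y \<le> sradius n a * (\<Sum>i<n. (y i)\<^sup>2)"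
    and nonneg_eigenvector: "\<exists>x. (\<forall>i. x i \<ge> 0) \<and> (\<exists>i<n. x i \<noteq> 0) \<and>
          (\<forall>i<n. (\<Sum>j<n. a i j * x j) = sradius n a * x i)"
proof -
  obtain x R where x: "(\<Sum>i<n. (x i)\<^sup>2) = 1" "quad_form n a x = R"
    and R: "\<And>y. quad_form n a y \<le> R * (\<Sum>i<n. (y i)\<^sup>2)"
    using quad_form_attains_max[OF n] by blast
  let ?x = "\<lambda>i. \<bar>x i\<bar>"
  have "quad_form n a ?x = R * (\<Sum>i<n. (?x i)\<^sup>2)"
    using quad_form_abs_mono[of n a x] nonneg R[of ?x] x by simp
  then have eig: "(\<Sum>j<n. a i j * ?x j) = R * ?x i" if "i < n" for i
    using quad_form_maximizer_eigenvector[of n a R ?x i] sym R that by simp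
  obtain k where k: "k < n" "x k \<noteq> 0"
    using x(1) by (metis (mono_tags, lifting) lessThan_iff sum.neutral zero_neq_one zero_power2)
  then have "R \<le> sradius n a"
    using real_eigenvalue_le_sradius[of n a ?x, OF eig] by simp
  \<comment> \<open>By the triangle inequality the moduli of a complex eigenvector for an eigenvalue
    of largest modulus have Rayleigh quotient at least \<open>sradius n a\<close>.\<close>
  moreover have "sradius n a \<le> R"
  proof -
    obtain w \<mu> l where w: "l < n" "w l \<noteq> 0" "norm \<mu> = sradius n a"
      "\<And>i. i < n \<Longrightarrow> (\<Sum>j<n. complex_of_real (a i j) * w j) = \<mu> * w i"
      using sradius_eigenvector[OF n, of a] by metis
    define s where "s = (\<Sum>i<n. (norm (w i))\<^sup>2)"
    have "(norm (w l))\<^sup>2 \<le> s"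
      unfolding s_def by (rule member_le_sum) (use w in auto)
    then have s: "s > 0"
      using w(2) by (smt (verit) zero_less_norm_iff zero_less_power)
    have "sradius n a * norm (w i) \<le> (\<Sum>j<n. a i j * norm (w j))" if "i < n" for i
    proof -
      have "sradius n a * norm (w i) = norm (\<Sum>j<n. complex_of_real (a i j) * w j)"
        by (simp add: w(4)[OF that] norm_mult w(3))
      also have "\<dots> \<le> (\<Sum>j<n. a i j * norm (w j))"
        by (rule sum_norm_le) (use that nonneg in \<open>simp add: norm_mult\<close>)
      finally show ?thesis .
    qed
    then have "(\<Sum>i<n. norm (w i) * (sradius n a * norm (w i)))
        \<le> (\<Sum>i<n. norm (w i) * (\<Sum>j<n. a i j * norm (w j)))"
      by (intro sum_mono mult_left_mono) auto
    then have "sradius n a * s \<le> quad_form n a (\<lambda>i. norm (w i))"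
      by (simp add: s_def quad_form_def sum_distrib_left power2_eq_square algebra_simps)
    also have "\<dots> \<le> R * s"
      unfolding s_def by (rule R)
    finally show ?thesis
      using s by simp
  qed
  ultimately have eq: "sradius n a = R"
    by simp
  show "quad_form n a y \<le> sradius n a * (\<Sum>i<n. (y i)\<^sup>2)"
    unfolding eq by (rule R)
  show "\<exists>x. (\<forall>i. x i \<ge> 0) \<and> (\<exists>i<n. x i \<noteq> 0) \<and>
          (\<forall>i<n. (\<Sum>j<n. a i j * x j) = sradius n a * x i)"
    using eig k unfolding eq by (intro exI[of _ ?x]) auto
qed

section \<open>Arc relations of weighted graphs\<close>

definition deg :: "('a \<times> 'a) set \<Rightarrow> 'a \<Rightarrow> nat" where
  "deg E v = card (E `` {v})"

definition arc_weight :: "(real \<Rightarrow> real \<Rightarrow> real) \<Rightarrow> ('a \<times> 'a) set \<Rightarrow> 'a \<Rightarrow> 'a \<Rightarrow> real" where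
  "arc_weight f E i j = (if (i, j) \<in> E then f (real (deg E i)) (real (deg E j)) else 0)"

text \<open>Required for all arguments from 1 on, since the transformed graphs realise degree pairs
  that do not occur in the original graph.\<close>

definition nonneg_weight :: "(real \<Rightarrow> real \<Rightarrow> real) \<Rightarrow> bool" where
  "nonneg_weight f \<longleftrightarrow> (\<forall>x\<ge>1. \<forall>y\<ge>1. f x y \<ge> 0)"

definition simple_arcs :: "nat \<Rightarrow> (nat \<times> nat) set \<Rightarrow> bool" where
  "simple_arcs n E \<longleftrightarrow> E \<subseteq> {..<n} \<times> {..<n} \<and> sym E \<and> irrefl E"

lemma simple_arcs_finite_nbrs: "simple_arcs n E \<Longrightarrow> finite (E `` S)"
  by (meson Image_subset finite_lessThan finite_subset simple_arcs_def)

lemma deg_ge_1: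
  assumes "simple_arcs n E" "(i, j) \<in> E"
  shows "deg E i \<ge> 1"
  using assms(2) simple_arcs_finite_nbrs[OF assms(1)]
  by (auto simp: deg_def Suc_le_eq card_gt_0_iff)

lemma card_arcs_eq_sum_deg:
  assumes "simple_arcs n E"
  shows "card E = (\<Sum>i<n. deg E i)"
proof -
  have "E = (SIGMA i:{..<n}. E `` {i})"
    using assms by (auto simp: simple_arcs_def)
  then have "card E = card (SIGMA i:{..<n}. E `` {i})"
    by simp
  also have "\<dots> = (\<Sum>i<n. deg E i)"
    unfolding deg_def by (rule card_SigmaI) (use simple_arcs_finite_nbrs[OF assms] in auto)
  finally show ?thesis .
qed

lemma arc_weight_sym:
  assumes "simple_arcs n E" "symmetric_weight f"
  shows "arc_weight f E i j = arc_weight f E j i"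
proof (cases "(i, j) \<in> E")
  case True
  then have "(j, i) \<in> E"
    using assms(1) by (auto simp: simple_arcs_def dest: symD)
  then show ?thesis
    using True assms deg_ge_1[OF assms(1)] by (auto simp: arc_weight_def symmetric_weight_def)
next
  case False
  then have "(j, i) \<notin> E"
    using assms(1) by (auto simp: simple_arcs_def dest: symD)
  then show ?thesis
    using False by (simp add: arc_weight_def)
qed

lemma arc_weight_nonneg:
  assumes "simple_arcs n E" "nonneg_weight f"
  shows "arc_weight f E i j \<ge> 0"
proof (cases "(i, j) \<in> E")
  case True
  then have "(j, i) \<in> E"
    using assms(1) by (auto simp: simple_arcs_def dest: symD)
  then show ?thesis
    using True assms deg_ge_1[OF assms(1)] by (auto simp: arc_weight_def nonneg_weight_def)
qed (simp add: arc_weight_def)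

section \<open>Inequalities supplied by property \<open>P*\<close>\<close>

lemma P_star_mono:
  assumes "property_P_star f" "1 \<le> y" "1 \<le> x" "x \<le> x'"
  shows "f x y \<le> f x' y"
  using assms unfolding property_P_star_def by (auto dest!: spec[of _ y] mono_onD[of _ _ x x'])

text \<open>The two inner points are convex combinations of the outer points \<open>k\<close> and
  \<open>k + p + q\<close> with interchanged weights, so the two convexity inequalities add up to
  the claim.\<close>

lemma convex_on_increment_le:
  fixes g :: "real \<Rightarrow> real"
  assumes "convex_on S g" "k \<in> S" "k + p + q \<in> S" "0 < p" "0 < q"
  shows "g (k + p) + g (k + q) \<le> g k + g (k + p + q)"
proof -
  define t where "t = q / (p + q)"
  have t: "0 \<le> t" "t \<le> 1" "t * (p + q) = q" "(1 - t) * (p + q) = p"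
    using assms(4,5) by (auto simp: t_def field_simps)
  have "t * k + (1 - t) * (k + p + q) = k + (1 - t) * (p + q)"
    "(1 - t) * k + t * (k + p + q) = k + t * (p + q)"
    by (simp_all add: algebra_simps)
  then have "g (k + p) \<le> t * g k + (1 - t) * g (k + p + q)"
    "g (k + q) \<le> (1 - t) * g k + t * g (k + p + q)"
    using assms(1-3) t unfolding convex_on_def
    by (metis add.commute add_diff_cancel_left' diff_add_cancel diff_ge_0_iff_ge real_scaleR_def)+
  then show ?thesis
    by (simp add: algebra_simps)
qed

text \<open>Meant for a common neighbour of degree \<open>y\<close>: \<open>k + p\<close> and
  \<open>k + q\<close> are the old degrees of the two vertices, \<open>k + p + q\<close> and
  \<open>k\<close> the new ones.\<close>

lemma P_star_convex:
  assumes "property_P_star f" "1 \<le> y" "1 \<le> k" "0 < p" "0 < q"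
  shows "f (k + p) y + f (k + q) y \<le> f k y + f (k + p + q) y"
  using assms convex_on_increment_le[of "{1..}" "\<lambda>x. f x y" k p q]
  unfolding property_P_star_def by auto

text \<open>Both pairs of arguments have the sum \<open>2 * k + p + q\<close>, while the gap widens
  from \<open>\<bar>p - q\<bar>\<close> to \<open>p + q\<close>, so condition (iii) applies.\<close>

lemma P_star_spread:
  assumes "property_P_star f" "1 \<le> k" "0 < p" "0 < q"
  shows "f (k + p) (k + q) \<le> f (k + p + q) k"
proof -
  have "\<bar>k + p - (k + q)\<bar> < \<bar>k + p + q - k\<bar>" "k + p + q + k = k + p + (k + q)"
    using assms by auto
  then show ?thesis
    using assms unfolding property_P_star_def
    by (metis add_increasing2 less_eq_real_def)
qed

lemma sum_remove2:
  fixes g :: "'a \<Rightarrow> 'b :: comm_monoid_add"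
  assumes "finite S" "u \<in> S" "v \<in> S" "u \<noteq> v"
  shows "sum g S = g u + g v + sum g (S - {u, v})"
proof -
  have "sum g S = g u + sum g (S - {u})" "sum g (S - {u}) = g v + sum g (S - {u} - {v})"
    using assms by (auto intro!: sum.remove)
  moreover have "S - {u} - {v} = S - {u, v}"
    by auto
  ultimately show ?thesis
    by (simp add: add.assoc)
qed

text \<open>Isolates the rows and columns of \<open>u\<close> and \<open>v\<close>, the only ones
  the transformation alters. Symmetry folds columns into rows, whence the factors 2.\<close>

lemma quad_form_remove2:
  assumes "u < n" "v < n" "u \<noteq> v"
    and sym: "\<And>i j. a i j = a j i" and "a u u = 0" "a v v = 0"
  shows "quad_form n a x = 2 * (\<Sum>w\<in>{..<n} - {u, v}. (a u w * x u + a v w * x v) * x w)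
    + 2 * a u v * x u * x v + (\<Sum>i\<in>{..<n} - {u, v}. \<Sum>j\<in>{..<n} - {u, v}. a i j * x i * x j)"
proof -
  let ?W = "{..<n} - {u, v}"
  have split: "sum g {..<n} = g u + g v + sum g ?W" for g :: "nat \<Rightarrow> real"
    using assms by (intro sum_remove2) auto
  have "(\<Sum>i\<in>?W. a i u * x i * x u) = (\<Sum>w\<in>?W. a u w * x u * x w)"
    "(\<Sum>i\<in>?W. a i v * x i * x v) = (\<Sum>w\<in>?W. a v w * x v * x w)"
    by (auto intro!: sum.cong simp: sym)
  then show ?thesis
    unfolding quad_form_def split using assms(5,6) sym[of v u]
    by (simp add: sum.distrib distrib_left distrib_right mult.assoc mult.left_commute mult.commute)
qed

section \<open>The Kelmans transformation\<close>

text \<open>The condition that \<open>u\<close> and \<open>v\<close> are adjacent or have a common neighbour serves two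
  purposes: the transformed graph stays connected, and \<open>v\<close> keeps degree at least 1, so that
  property \<open>P*\<close> still applies.\<close>

locale kelmans =
  fixes n :: nat and E :: "(nat \<times> nat) set" and u v :: nat
  assumes simple: "simple_arcs n E"
    and u: "u < n" and v: "v < n" and neq: "u \<noteq> v"
    and near: "(u, v) \<in> E \<or> E `` {u} \<inter> E `` {v} \<noteq> {}"
    and private_u: "E `` {u} - E `` {v} - {v} \<noteq> {}"
    and private_v: "E `` {v} - E `` {u} - {u} \<noteq> {}"
begin

definition "A = E `` {u} - E `` {v} - {v}"
definition "B = E `` {v} - E `` {u} - {u}"
definition "C = E `` {u} \<inter> E `` {v}"
text \<open>The part of the degree shared by \<open>u\<close> and \<open>v\<close>, and exactly the
  degree that \<open>v\<close> retains once its private neighbours \<open>B\<close> have moved to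
  \<open>u\<close>.\<close>

definition "k = card C + (if (u, v) \<in> E then 1 else 0)"

definition "E' = (E - {v} \<times> B - B \<times> {v}) \<union> {u} \<times> B \<union> B \<times> {u}"

lemma E_sym: "(a, b) \<in> E \<longleftrightarrow> (b, a) \<in> E"
  using simple by (auto simp: simple_arcs_def dest: symD)

lemma E_irrefl [simp]: "(a, a) \<notin> E"
  using simple by (auto simp: simple_arcs_def dest: irreflD)

lemma fin [simp]: "finite (E `` S)"
  using simple by (rule simple_arcs_finite_nbrs)

lemma finABC [simp]: "finite A" "finite B" "finite C"
  by (simp_all add: A_def B_def C_def)

lemma k_ge_1: "k \<ge> 1"
proof (cases "(u, v) \<in> E")
  case False
  then have "C \<noteq> {}"
    using near by (simp add: C_def)
  then show ?thesis
    by (simp add: k_def Suc_le_eq card_gt_0_iff)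
qed (simp add: k_def)

lemma simple': "simple_arcs n E'"
proof -
  have "E' \<subseteq> {..<n} \<times> {..<n}"
    using simple u by (auto simp: E'_def B_def simple_arcs_def)
  moreover have "sym E'"
    using simple by (auto simp: E'_def B_def simple_arcs_def sym_def)
  moreover have "irrefl E'"
    using simple by (auto simp: E'_def B_def simple_arcs_def irrefl_def)
  ultimately show ?thesis
    by (simp add: simple_arcs_def)
qed

lemma nbrs_u: "E `` {u} = A \<union> (C \<union> (if (u, v) \<in> E then {v} else {}))"
  by (auto simp: A_def C_def)

lemma nbrs_v: "E `` {v} = B \<union> (C \<union> (if (u, v) \<in> E then {u} else {}))"
  using E_sym[of u v] by (auto simp: B_def C_def)

lemma nbrs'_u: "E' `` {u} = A \<union> B \<union> (C \<union> (if (u, v) \<in> E then {v} else {}))"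
  using neq E_sym[of u v] by (auto simp: E'_def A_def B_def C_def)

lemma nbrs'_v: "E' `` {v} = C \<union> (if (u, v) \<in> E then {u} else {})"
  using neq E_sym[of u v] by (auto simp: E'_def A_def B_def C_def)

lemma card_core:
  "card (C \<union> (if (u, v) \<in> E then {v} else {})) = k"
  "card (C \<union> (if (u, v) \<in> E then {u} else {})) = k"
  by (auto simp: k_def C_def)

lemma deg_u: "deg E u = k + card A"
proof -
  have "A \<inter> (C \<union> (if (u, v) \<in> E then {v} else {})) = {}"
    by (auto simp: A_def C_def)
  then show ?thesis
    unfolding deg_def nbrs_u by (subst card_Un_disjoint) (auto simp: card_core[simplified])
qed

lemma deg_v: "deg E v = k + card B"
proof -
  have "B \<inter> (C \<union> (if (u, v) \<in> E then {u} else {})) = {}"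
    by (auto simp: B_def C_def)
  then show ?thesis
    unfolding deg_def nbrs_v by (subst card_Un_disjoint) (auto simp: card_core[simplified])
qed

lemma deg'_u: "deg E' u = k + card A + card B"
proof -
  have "(A \<union> B) \<inter> (C \<union> (if (u, v) \<in> E then {v} else {})) = {}" "A \<inter> B = {}"
    by (auto simp: A_def B_def C_def)
  then show ?thesis
    unfolding deg_def nbrs'_u by (subst card_Un_disjoint) (auto simp: card_core[simplified] card_Un_disjoint)
qed

lemma deg'_v: "deg E' v = k"
  unfolding deg_def nbrs'_v by (rule card_core)

text \<open>A vertex of \<open>B\<close> exchanges its neighbour \<open>v\<close> for
  \<open>u\<close>; any other vertex keeps its neighbourhood.\<close>

lemma deg'_other:
  assumes "w \<noteq> u" "w \<noteq> v"
  shows "deg E' w = deg E w"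
proof (cases "w \<in> B")
  case True
  then have nb: "u \<notin> E `` {w}" "v \<in> E `` {w}"
    using assms E_sym[of w u] E_sym[of w v] by (auto simp: B_def)
  have "E' `` {w} = insert u (E `` {w} - {v})"
    using True assms by (auto simp: E'_def)
  then show ?thesis
    using nb card_Suc_Diff1[of "E `` {w}" v] by (simp add: deg_def)
next
  case False
  then have "E' `` {w} = E `` {w}"
    using assms by (auto simp: E'_def)
  then show ?thesis
    by (simp add: deg_def)
qed

lemma card_A_pos: "card A > 0" and card_B_pos: "card B > 0"
  using private_u private_v by (simp_all add: A_def B_def card_gt_0_iff)

lemma sum_deg_split: "(\<Sum>i<n. h (deg D i)) = h (deg D u) + h (deg D v) + (\<Sum>i\<in>{..<n} - {u, v}. h (deg D i))"
  for h :: "nat \<Rightarrow> nat"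
  using u v neq by (intro sum_remove2) auto

lemma sum_deg'_other: "(\<Sum>i\<in>{..<n} - {u, v}. h (deg E' i)) = (\<Sum>i\<in>{..<n} - {u, v}. h (deg E i))"
  for h :: "nat \<Rightarrow> nat"
  by (intro sum.cong) (auto simp: deg'_other)

lemma card': "card E' = card E"
  using sum_deg_split[of id E] sum_deg_split[of id E'] sum_deg'_other[of id]
  by (simp add: card_arcs_eq_sum_deg[OF simple] card_arcs_eq_sum_deg[OF simple'] deg_u deg_v deg'_u deg'_v)

text \<open>The degrees \<open>k + card A\<close> and \<open>k + card B\<close> become
  \<open>k + card A + card B\<close> and \<open>k\<close>, which raises the sum of squares by
  \<open>2 * card A * card B\<close>.\<close>

lemma sum_deg_sq_less: "(\<Sum>i<n. (deg E i)\<^sup>2) < (\<Sum>i<n. (deg E' i)\<^sup>2)"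
  using sum_deg_split[of "\<lambda>d. d\<^sup>2" E] sum_deg_split[of "\<lambda>d. d\<^sup>2" E'] sum_deg'_other[of "\<lambda>d. d\<^sup>2"]
    mult_pos_pos[OF card_A_pos card_B_pos]
  by (simp add: deg_u deg_v deg'_u deg'_v power2_eq_square algebra_simps)

text \<open>The transformed graph still joins \<open>u\<close> and \<open>v\<close>, by their edge
  or through a common neighbour. A removed edge from \<open>v\<close> to \<open>B\<close> is
  therefore replaced by a detour through \<open>u\<close>.\<close>

lemma E_subset_rtrancl: "E \<subseteq> E'\<^sup>*"
proof -
  have sym': "(a, b) \<in> E' \<longleftrightarrow> (b, a) \<in> E'" for a b
    using simple' by (auto simp: simple_arcs_def dest: symD)
  have "(v, u) \<in> E'\<^sup>*"
  proof (cases "(u, v) \<in> E")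
    case True
    then have "(v, u) \<in> E'"
      using nbrs'_v by auto
    then show ?thesis by blast
  next
    case False
    then obtain c where "c \<in> C"
      using near by (auto simp: C_def)
    then have "(v, c) \<in> E'" "(c, u) \<in> E'"
      using nbrs'_v nbrs'_u sym' by auto
    then show ?thesis by (meson converse_rtrancl_into_rtrancl r_into_rtrancl)
  qed
  moreover have "(u, v) \<in> E'\<^sup>*"
    using calculation simple' by (meson simple_arcs_def symD sym_rtrancl)
  moreover have "(u, b) \<in> E'" "(b, u) \<in> E'" if "b \<in> B" for b
    using that by (auto simp: E'_def)
  ultimately have "(v, b) \<in> E'\<^sup>*" "(b, v) \<in> E'\<^sup>*" if "b \<in> B" for b
    using that by (meson rtrancl.rtrancl_into_rtrancl converse_rtrancl_into_rtrancl)+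
  moreover have "(a, b) \<in> E' \<or> a = v \<and> b \<in> B \<or> b = v \<and> a \<in> B" if "(a, b) \<in> E" for a b
    using that by (auto simp: E'_def)
  ultimately show ?thesis
    by (metis r_into_rtrancl subrelI)
qed

end

text \<open>The vector \<open>x\<close> is any nonnegative one at first; it becomes an eigenvector
  for the spectral radius only when two radii are compared. The entry at the receiving vertex
  \<open>u\<close> is the larger one.\<close>

locale weighted_kelmans = kelmans +
  fixes f :: "real \<Rightarrow> real \<Rightarrow> real" and x :: "nat \<Rightarrow> real"
  assumes f_sym: "symmetric_weight f" and f_P: "property_P_star f" and f_nonneg: "nonneg_weight f"
    and x_nonneg: "\<And>i. x i \<ge> 0" and x_vu: "x v \<le> x u"
begin

abbreviation "a \<equiv> arc_weight f E"
abbreviation "a' \<equiv> arc_weight f E'"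

lemma real_deg:
  "real (deg E u) = real k + real (card A)" "real (deg E v) = real k + real (card B)"
  "real (deg E' u) = real k + real (card A) + real (card B)" "real (deg E' v) = real k"
  by (simp_all add: deg_u deg_v deg'_u deg'_v)

lemma real_pos: "real k \<ge> 1" "real (card A) > 0" "real (card B) > 0"
  using k_ge_1 card_A_pos card_B_pos by auto

lemma weight_uv: "a u v \<le> a' u v"
proof (cases "(u, v) \<in> E")
  case True
  then have "(u, v) \<in> E'"
    using nbrs'_u by auto
  then show ?thesis
    using True P_star_spread[OF f_P real_pos] by (simp add: arc_weight_def real_deg)
next
  case False
  then show ?thesis
    using arc_weight_nonneg[OF simple' f_nonneg] by (simp add: arc_weight_def)
qed

text \<open>A neighbour \<open>w\<close> of \<open>u\<close> other than \<open>v\<close> keeps its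
  degree while that of \<open>u\<close> grows, so monotonicity applies; \<open>w = v\<close> is the
  case of condition (iii).\<close>

lemma weight_u: "a u w \<le> a' u w"
proof (cases "(u, w) \<in> E \<and> w \<noteq> v")
  case True
  then have w: "(u, w) \<in> E" "(u, w) \<in> E'" "w \<noteq> u" "w \<noteq> v" "deg E w \<ge> 1"
    using nbrs_u nbrs'_u E_sym[of u w] deg_ge_1[OF simple, of w u] by auto
  then show ?thesis
    using P_star_mono[OF f_P, of "real (deg E w)" "real (deg E u)" "real (deg E' u)"] real_pos
    by (simp add: arc_weight_def deg'_other real_deg)
next
  case False
  then show ?thesis
    using weight_uv arc_weight_nonneg[OF simple' f_nonneg] by (auto simp: arc_weight_def[of f E])
qed

text \<open>The edge \<open>vw\<close> becomes \<open>uw\<close>: the degree of \<open>w\<close> is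
  unchanged, and the new degree of \<open>u\<close> exceeds the old degree of \<open>v\<close> by
  \<open>card A\<close>.\<close>

lemma weight_u_private_v:
  assumes "w \<in> B"
  shows "a v w \<le> a' u w"
proof -
  have w: "(v, w) \<in> E" "(u, w) \<in> E'" "w \<noteq> u" "w \<noteq> v" "deg E w \<ge> 1"
    using assms E_sym deg_ge_1[OF simple] by (auto simp: B_def E'_def)
  then show ?thesis
    using P_star_mono[OF f_P, of "real (deg E w)" "real (deg E v)" "real (deg E' u)"] real_pos
    by (simp add: arc_weight_def deg'_other real_deg)
qed

text \<open>For a common neighbour \<open>w\<close> convexity says that \<open>u\<close> gains at least what \<open>v\<close> loses, and the gain
  is counted with the larger entry \<open>x u\<close>.\<close>

lemma weight_column:
  assumes "w \<noteq> u" "w \<noteq> v"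
  shows "a u w * x u + a v w * x v \<le> a' u w * x u + a' v w * x v"
proof -
  consider "w \<in> B" | "w \<in> C" | "w \<notin> B" "w \<notin> C" by blast
  then show ?thesis
  proof cases
    case 1
    then have "(u, w) \<notin> E" "w \<notin> C"
      by (auto simp: B_def C_def)
    moreover have "w \<notin> E' `` {v}"
      unfolding nbrs'_v using \<open>w \<notin> C\<close> assms by auto
    ultimately have "a u w = 0" "a' v w = 0"
      by (auto simp: arc_weight_def)
    moreover have "a v w * x v \<le> a' u w * x u"
      using weight_u_private_v[OF 1] x_vu x_nonneg arc_weight_nonneg[OF simple' f_nonneg]
      by (intro mult_mono) auto
    ultimately show ?thesis
      by simp
  next
    case 2
    let ?g = "\<lambda>d. f d (real (deg E w))"
    have w: "(u, w) \<in> E" "(v, w) \<in> E" "(u, w) \<in> E'" "(v, w) \<in> E'" "deg E w \<ge> 1"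
      using 2 nbrs'_u nbrs'_v E_sym[of u w] deg_ge_1[OF simple, of w u] by (auto simp: C_def)
    define p where "p = ?g (real (deg E' u)) - ?g (real (deg E u))"
    define q where "q = ?g (real (deg E v)) - ?g (real (deg E' v))"
    have "q \<le> p"
      using P_star_convex[OF f_P _ real_pos, of "real (deg E w)"] w
      by (simp add: p_def q_def real_deg)
    moreover have "0 \<le> q"
      using P_star_mono[OF f_P, of "real (deg E w)" "real k" "real (deg E v)"] w real_pos
      by (simp add: q_def real_deg)
    ultimately have "q * x v \<le> p * x u"
      using x_vu x_nonneg by (intro mult_mono) auto
    then show ?thesis
      using w assms by (simp add: arc_weight_def deg'_other p_def q_def algebra_simps)
  next
    case 3
    then have "(v, w) \<notin> E"
      using assms by (auto simp: B_def C_def)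
    then have "a v w = 0"
      by (simp add: arc_weight_def)
    then show ?thesis
      using weight_u[of w] x_nonneg arc_weight_nonneg[OF simple' f_nonneg, of v w]
      by (simp add: mult_right_mono add_increasing2)
  qed
qed

text \<open>Entries avoiding \<open>u\<close> and \<open>v\<close> are unchanged, so the comparison
  reduces to the columns of the other vertices and the entry at \<open>u\<close>,
  \<open>v\<close>.\<close>

lemma quad_form_le: "quad_form n a x \<le> quad_form n a' x"
proof -
  let ?W = "{..<n} - {u, v}"
  have irr: "(i, i) \<notin> E'" for i
    using simple' by (auto simp: simple_arcs_def dest: irreflD)
  have "(\<Sum>i\<in>?W. \<Sum>j\<in>?W. a i j * x i * x j) = (\<Sum>i\<in>?W. \<Sum>j\<in>?W. a' i j * x i * x j)"
  proof (intro sum.cong refl)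
    fix i j assume ij: "i \<in> ?W" "j \<in> ?W"
    then have "(i, j) \<in> E' \<longleftrightarrow> (i, j) \<in> E"
      by (auto simp: E'_def)
    then show "a i j * x i * x j = a' i j * x i * x j"
      using ij by (simp add: arc_weight_def deg'_other)
  qed
  moreover have "(\<Sum>w\<in>?W. (a u w * x u + a v w * x v) * x w) \<le> (\<Sum>w\<in>?W. (a' u w * x u + a' v w * x v) * x w)"
    by (intro sum_mono mult_right_mono weight_column) (auto simp: x_nonneg)
  moreover have "a u v * (x u * x v) \<le> a' u v * (x u * x v)"
    by (intro mult_right_mono weight_uv) (simp add: x_nonneg)
  ultimately show ?thesis
    using quad_form_remove2[OF u v neq, of a x] quad_form_remove2[OF u v neq, of a' x]
      arc_weight_sym[OF simple f_sym] arc_weight_sym[OF simple' f_sym] irr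
    by (simp add: arc_weight_def[of _ _ u u] arc_weight_def[of _ _ v v] mult.assoc)
qed

text \<open>No entry of row \<open>u\<close> decreases, and a vertex of \<open>B\<close> turns from
  a non-neighbour of \<open>u\<close> into a neighbour joined with positive weight.\<close>

lemma row_u_less:
  assumes "\<And>i j. (i, j) \<in> E \<Longrightarrow> a i j > 0" "\<And>i. i < n \<Longrightarrow> x i > 0"
  shows "(\<Sum>j<n. a u j * x j) < (\<Sum>j<n. a' u j * x j)"
proof -
  obtain w where w: "w \<in> B"
    using card_B_pos by (auto simp: card_gt_0_iff)
  then have "(v, w) \<in> E" "a u w = 0" and wn: "w < n"
    using simple by (auto simp: B_def arc_weight_def simple_arcs_def)
  then have "a u w < a' u w"
    using assms(1)[of v w] weight_u_private_v[OF w] by simp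
  then show ?thesis
    using wn assms(2) x_nonneg
    by (intro sum_strict_mono_ex1) (auto intro!: mult_right_mono weight_u bexI[of _ w])
qed

end

section \<open>Connectivity and strict increase of the spectral radius\<close>

definition connected_arcs :: "nat \<Rightarrow> (nat \<times> nat) set \<Rightarrow> bool" where
  "connected_arcs n E \<longleftrightarrow> (\<forall>i<n. \<forall>j<n. (i, j) \<in> E\<^sup>*)"

text \<open>A zero entry makes its row of the eigenvalue equation a vanishing sum of nonnegative
  terms, so all neighbours have zero entries too. Connectivity would spread this to the nonzero
  entry at \<open>k\<close>.\<close>

lemma nonneg_eigenvector_pos:
  assumes "simple_arcs n E" "connected_arcs n E"
    and nonneg: "\<And>i j. a i j \<ge> 0" and pos: "\<And>i j. (i, j) \<in> E \<Longrightarrow> a i j > 0"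
    and x: "\<And>i. x i \<ge> (0 :: real)" "k < n" "x k \<noteq> 0"
    and eig: "\<And>i. i < n \<Longrightarrow> (\<Sum>j<n. a i j * x j) = \<rho> * x i"
    and "i < n"
  shows "x i > 0"
proof (rule ccontr)
  assume "\<not> x i > 0"
  then have i: "x i = 0"
    using x(1)[of i] by simp
  have "(i, k) \<in> E\<^sup>*"
    using assms(2) \<open>i < n\<close> \<open>k < n\<close> by (simp add: connected_arcs_def)
  then have "x k = 0"
  proof (induction rule: rtrancl_induct)
    case base
    show ?case by (rule i)
  next
    case (step y z)
    then have "y < n" "z < n"
      using assms(1) by (auto simp: simple_arcs_def)
    then have "(\<Sum>j<n. a y j * x j) = 0"
      using eig step.IH by simp
    then have "a y z * x z = 0"
      using \<open>z < n\<close> nonneg x(1) by (subst (asm) sum_nonneg_eq_0_iff) auto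
    then show ?case
      using pos[OF step.hyps(2)] by simp
  qed
  then show False
    using x(3) by simp
qed

lemma quad_form_eigenvector:
  assumes "\<And>i. i < n \<Longrightarrow> (\<Sum>j<n. a i j * x j) = \<rho> * x i"
  shows "quad_form n a x = \<rho> * (\<Sum>i<n. (x i)\<^sup>2)"
proof -
  have "quad_form n a x = (\<Sum>i<n. x i * (\<Sum>j<n. a i j * x j))"
    by (simp add: quad_form_def sum_distrib_left mult.assoc mult.left_commute mult.commute)
  also have "\<dots> = (\<Sum>i<n. x i * (\<rho> * x i))"
    using assms by simp
  finally show ?thesis
    by (simp add: sum_distrib_left power2_eq_square mult.left_commute)
qed

context weighted_kelmans
begin

context
  fixes l
  assumes eig: "\<And>i. i < n \<Longrightarrow> (\<Sum>j<n. a i j * x j) = sradius n a * x i"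
    and l: "l < n" "x l \<noteq> 0"
begin

lemma n_pos: "n > 0"
  using u by simp

lemma norm_pos: "(\<Sum>i<n. (x i)\<^sup>2) > 0"
proof -
  have "(x l)\<^sup>2 \<le> (\<Sum>i<n. (x i)\<^sup>2)"
    using l by (intro member_le_sum) auto
  then show ?thesis
    using l by (smt (verit) zero_less_power2)
qed

lemma quad_form'_le: "quad_form n a' y \<le> sradius n a' * (\<Sum>i<n. (y i)\<^sup>2)"
  using n_pos arc_weight_sym[OF simple' f_sym] arc_weight_nonneg[OF simple' f_nonneg]
  by (rule quad_form_le_sradius)

lemma sradius_le: "sradius n a \<le> sradius n a'"
proof -
  have "sradius n a * (\<Sum>i<n. (x i)\<^sup>2) \<le> sradius n a' * (\<Sum>i<n. (x i)\<^sup>2)"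
    using quad_form_le quad_form'_le[of x] quad_form_eigenvector[of n a x, OF eig] by simp
  then show ?thesis
    using norm_pos by simp
qed

text \<open>If the radii agreed, \<open>x\<close> would maximise the Rayleigh quotient of the new
  matrix as well, hence be an eigenvector of both matrices for the same eigenvalue. Row
  \<open>u\<close> excludes this, as \<open>x\<close> is positive.\<close>

lemma sradius_less:
  assumes "connected_arcs n E" "\<And>i j. (i, j) \<in> E \<Longrightarrow> a i j > 0"
  shows "sradius n a < sradius n a'"
proof (rule ccontr)
  assume "\<not> sradius n a < sradius n a'"
  then have eq: "sradius n a' = sradius n a"
    using sradius_le by simp
  have "quad_form n a' x = sradius n a' * (\<Sum>i<n. (x i)\<^sup>2)"
    using quad_form_le quad_form'_le[of x] quad_form_eigenvector[of n a x, OF eig] eq by simp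
  then have "(\<Sum>j<n. a' u j * x j) = sradius n a' * x u"
    using arc_weight_sym[OF simple' f_sym] quad_form'_le u
    by (intro quad_form_maximizer_eigenvector)
  moreover have "x i > 0" if "i < n" for i
    using nonneg_eigenvector_pos[of n E a x l "sradius n a" i] simple assms x_nonneg l eig that
      arc_weight_nonneg[OF simple f_nonneg] by blast
  then have "(\<Sum>j<n. a u j * x j) < (\<Sum>j<n. a' u j * x j)"
    using assms(2) by (intro row_u_less)
  ultimately show False
    using eig[OF u] eq by simp
qed

end

end

text \<open>Each of the \<open>n + 1\<close> edges is present as two opposite arcs.\<close>

definition bicyclic_arcs :: "nat \<Rightarrow> (nat \<times> nat) set \<Rightarrow> bool" where
  "bicyclic_arcs n E \<longleftrightarrow> simple_arcs n E \<and> connected_arcs n E \<and> card E = 2 * (n + 1)"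

lemma kelmans_swap: "kelmans n E u v \<Longrightarrow> kelmans n E v u"
  unfolding kelmans_def simple_arcs_def by (auto dest: symD)

lemma kelmans_increases_sradius:
  assumes E: "bicyclic_arcs n E" and "kelmans n E u v"
    and f: "symmetric_weight f" "property_P_star f" "nonneg_weight f"
  obtains E' where "bicyclic_arcs n E'"
    "(\<Sum>i<n. (deg E i)\<^sup>2) < (\<Sum>i<n. (deg E' i)\<^sup>2)"
    "sradius n (arc_weight f E) \<le> sradius n (arc_weight f E')"
    "(\<And>i j. (i, j) \<in> E \<Longrightarrow> arc_weight f E i j > 0) \<Longrightarrow>
      sradius n (arc_weight f E) < sradius n (arc_weight f E')"
proof -
  have simple: "simple_arcs n E" and conn: "connected_arcs n E"
    using E by (simp_all add: bicyclic_arcs_def)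
  have "n > 0"
    using \<open>kelmans n E u v\<close> by (simp add: kelmans_def)
  then obtain x l where x: "\<And>i. x i \<ge> 0" "l < n" "x l \<noteq> 0"
    "\<And>i. i < n \<Longrightarrow> (\<Sum>j<n. arc_weight f E i j * x j) = sradius n (arc_weight f E) * x i"
    using nonneg_eigenvector[of n "arc_weight f E"] arc_weight_sym[OF simple f(1)]
      arc_weight_nonneg[OF simple f(3)] by metis
  \<comment> \<open>The conditions on the pair are symmetric, so the vertex with the larger entry of
    the eigenvector can be made the receiving one.\<close>
  obtain u' v' where "kelmans n E u' v'" "x v' \<le> x u'"
    using \<open>kelmans n E u v\<close> kelmans_swap by (metis linear)
  then interpret weighted_kelmans n E u' v' f x
    using f x(1) by (auto simp: weighted_kelmans_def weighted_kelmans_axioms_def)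
  have "connected_arcs n E'"
    using conn rtrancl_subset_rtrancl[OF E_subset_rtrancl] by (auto simp: connected_arcs_def)
  then have "bicyclic_arcs n E'"
    using E simple' card' by (simp add: bicyclic_arcs_def)
  then show ?thesis
    using that sum_deg_sq_less sradius_le[OF x(4,2,3)] sradius_less[OF x(4,2,3) conn] by blast
qed

section \<open>Isomorphism\<close>

definition arcs_iso :: "nat \<Rightarrow> (nat \<times> nat) set \<Rightarrow> (nat \<times> nat) set \<Rightarrow> bool" where
  "arcs_iso n E F \<longleftrightarrow> (\<exists>\<pi>. bij_betw \<pi> {..<n} {..<n} \<and>
     (\<forall>i<n. \<forall>j<n. (i, j) \<in> E \<longleftrightarrow> (\<pi> i, \<pi> j) \<in> F))"

lemma arcs_iso_sym:
  assumes "arcs_iso n E F"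
  shows "arcs_iso n F E"
proof -
  obtain \<pi> where bij: "bij_betw \<pi> {..<n} {..<n}"
    and \<pi>: "\<And>i j. i < n \<Longrightarrow> j < n \<Longrightarrow> (i, j) \<in> E \<longleftrightarrow> (\<pi> i, \<pi> j) \<in> F"
    using assms by (auto simp: arcs_iso_def)
  let ?\<sigma> = "the_inv_into {..<n} \<pi>"
  have inv: "bij_betw ?\<sigma> {..<n} {..<n}"
    using bij by (rule bij_betw_the_inv_into)
  have "?\<sigma> i < n" "\<pi> (?\<sigma> i) = i" if "i < n" for i
    using that inv bij f_the_inv_into_f_bij_betw[OF bij, of i] by (auto dest: bij_betwE)
  then show ?thesis
    using inv \<pi> unfolding arcs_iso_def by (metis (no_types))
qed

text \<open>Isomorphisms preserve degrees and hence weights, so a nonnegative eigenvector of the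
  matrix of \<open>F\<close> pulls back along \<open>\<pi>\<close> to an eigenvector for
  \<open>E\<close> with the same eigenvalue.\<close>

lemma sradius_le_if_arcs_iso:
  assumes iso: "arcs_iso n E F" and E: "simple_arcs n E" and F: "simple_arcs n F"
    and f: "symmetric_weight f" "nonneg_weight f" and "n > 0"
  shows "sradius n (arc_weight f F) \<le> sradius n (arc_weight f E)"
proof -
  obtain \<pi> where bij: "bij_betw \<pi> {..<n} {..<n}"
    and \<pi>: "\<And>i j. i < n \<Longrightarrow> j < n \<Longrightarrow> (i, j) \<in> E \<longleftrightarrow> (\<pi> i, \<pi> j) \<in> F"
    using iso by (auto simp: arcs_iso_def)
  have lt: "\<pi> i < n" if "i < n" for i
    using that bij by (auto dest: bij_betwE)
  have surj: "\<exists>i<n. \<pi> i = j" if "j < n" for j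
    using that bij by (metis (no_types, lifting) bij_betw_imp_surj_on imageE lessThan_iff)
  have "deg F (\<pi> i) = deg E i" if "i < n" for i
  proof -
    have "F `` {\<pi> i} = \<pi> ` (E `` {i})"
    proof (intro Set.set_eqI iffI)
      fix j assume j: "j \<in> F `` {\<pi> i}"
      then have "j < n"
        using F by (auto simp: simple_arcs_def)
      then obtain m where "m < n" "\<pi> m = j"
        using surj by blast
      then show "j \<in> \<pi> ` (E `` {i})"
        using j \<pi>[OF that, of m] by auto
    next
      fix j assume "j \<in> \<pi> ` (E `` {i})"
      then obtain m where "(i, m) \<in> E" "j = \<pi> m"
        by auto
      moreover from this have "m < n"
        using E by (auto simp: simple_arcs_def)
      ultimately show "j \<in> F `` {\<pi> i}"
        using \<pi>[OF that, of m] by auto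
    qed
    moreover have "inj_on \<pi> (E `` {i})"
      by (rule inj_on_subset[of \<pi> "{..<n}"]) (use bij E in \<open>auto simp: bij_betw_def simple_arcs_def\<close>)
    ultimately show ?thesis
      by (simp add: deg_def card_image)
  qed
  then have weight: "arc_weight f E i j = arc_weight f F (\<pi> i) (\<pi> j)" if "i < n" "j < n" for i j
    using that \<pi> by (simp add: arc_weight_def)
  obtain x l where x: "l < n" "x l \<noteq> 0"
    "\<And>i. i < n \<Longrightarrow> (\<Sum>j<n. arc_weight f F i j * x j) = sradius n (arc_weight f F) * x i"
    using nonneg_eigenvector[of n "arc_weight f F"] arc_weight_sym[OF F f(1)]
      arc_weight_nonneg[OF F f(2)] \<open>n > 0\<close> by metis
  have "(\<Sum>j<n. arc_weight f E i j * x (\<pi> j)) = sradius n (arc_weight f F) * x (\<pi> i)" if "i < n" for i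
  proof -
    have "(\<Sum>j<n. arc_weight f E i j * x (\<pi> j)) = (\<Sum>j<n. arc_weight f F (\<pi> i) (\<pi> j) * x (\<pi> j))"
      using weight that by simp
    also have "\<dots> = (\<Sum>j<n. arc_weight f F (\<pi> i) j * x j)"
      by (rule sum.reindex_bij_betw[OF bij])
    finally show ?thesis
      using x(3)[OF lt[OF that]] by simp
  qed
  moreover obtain k where "k < n" "\<pi> k = l"
    using surj x(1) by blast
  ultimately show ?thesis
    using real_eigenvalue_le_sradius[of n "arc_weight f E" "\<lambda>i. x (\<pi> i)" _ k] x(2) by simp
qed

lemma sradius_eq_if_arcs_iso:
  assumes "arcs_iso n E F" "simple_arcs n E" "simple_arcs n F"
    "symmetric_weight f" "nonneg_weight f" "n > 0"
  shows "sradius n (arc_weight f E) = sradius n (arc_weight f F)"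
  using sradius_le_if_arcs_iso[OF assms] sradius_le_if_arcs_iso[OF arcs_iso_sym[OF assms(1)] assms(3,2,4-6)]
  by simp

section \<open>Bicyclic graphs without Kelmans transformations\<close>

text \<open>A vertex \<open>x\<close> of maximum degree dominates: the set of \<open>x\<close> and
  its neighbours is closed under arcs, and by connectivity it contains all vertices.\<close>

lemma exists_dominating_vertex:
  assumes simple: "simple_arcs n E" and conn: "connected_arcs n E" and "n > 0"
    and no_kelmans: "\<And>u v. \<not> kelmans n E u v"
  obtains x where "x < n" "\<And>y. y < n \<Longrightarrow> y \<noteq> x \<Longrightarrow> (x, y) \<in> E"
proof -
  have "Max (deg E ` {..<n}) \<in> deg E ` {..<n}"
    using \<open>n > 0\<close> by (intro Max_in) auto
  then obtain x where x: "x < n" "deg E x = Max (deg E ` {..<n})"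
    by auto
  have x_max: "deg E y \<le> deg E x" if "y < n" for y
    unfolding x(2) using that by (intro Max_ge) auto
  have sym: "(b, a) \<in> E" if "(a, b) \<in> E" for a b
    using that simple by (auto simp: simple_arcs_def dest: symD)
  have irrefl: "(a, a) \<notin> E" for a
    using simple by (auto simp: simple_arcs_def dest: irreflD)
  have closed: "z = x \<or> (x, z) \<in> E" if "(x, y) \<in> E" "(y, z) \<in> E" for y z
  proof (rule ccontr)
    assume z: "\<not> (z = x \<or> (x, z) \<in> E)"
    have lt: "y < n" "z < n"
      using that simple by (auto simp: simple_arcs_def)
    have "E `` {x} - E `` {y} - {y} = {}"
    proof (rule ccontr)
      assume "E `` {x} - E `` {y} - {y} \<noteq> {}"
      moreover have "z \<in> E `` {y} - E `` {x} - {x}"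
        using that z by auto
      ultimately have "kelmans n E x y"
        unfolding kelmans_def using simple x lt that irrefl by auto
      then show False
        using no_kelmans by blast
    qed
    \<comment> \<open>For \<open>z\<close> at distance two from \<open>x\<close> through
      \<open>y\<close>, every neighbour of \<open>x\<close> except \<open>y\<close> is one of
      \<open>y\<close>. With \<open>x\<close> and \<open>z\<close> added, \<open>y\<close> has a
      larger degree than \<open>x\<close>.\<close>
    then have "insert z (insert x (E `` {x} - {y})) \<subseteq> E `` {y}"
      using that sym by auto
    then have "card (insert z (insert x (E `` {x} - {y}))) \<le> deg E y"
      unfolding deg_def using simple by (intro card_mono simple_arcs_finite_nbrs)
    moreover have "card (insert z (insert x (E `` {x} - {y}))) = Suc (Suc (card (E `` {x} - {y})))"
      using z irrefl simple_arcs_finite_nbrs[OF simple] by auto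
    moreover have "Suc (card (E `` {x} - {y})) = deg E x"
      unfolding deg_def using that simple_arcs_finite_nbrs[OF simple] by (intro card_Suc_Diff1) auto
    ultimately have "deg E x < deg E y"
      by simp
    then show False
      using x_max[OF lt(1)] by simp
  qed
  have "y = x \<or> (x, y) \<in> E" if "y < n" for y
  proof -
    have "(x, y) \<in> E\<^sup>*"
      using conn x(1) that by (simp add: connected_arcs_def)
    then show ?thesis
      by (induction rule: rtrancl_induct) (use closed in auto)
  qed
  then show ?thesis
    using that x(1) by blast
qed

section \<open>Identifying the graph without transformations\<close>

definition G1_arcs :: "nat \<Rightarrow> (nat \<times> nat) set" where
  "G1_arcs n = G1_half n \<union> (G1_half n)\<inverse>"

lemma G1_arcs_iff:
  assumes "i < n" "j < n"
  shows "(i, j) \<in> G1_arcs n \<longleftrightarrow> i \<noteq> j \<and> (i = 0 \<or> j = 0 \<or> (i, j) \<in> {(1, 2), (2, 1), (1, 3), (3, 1)})"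
proof -
  have "(i, j) \<in> G1_half n \<longleftrightarrow> i = 0 \<and> j \<noteq> 0 \<or> i = 1 \<and> (j = 2 \<or> j = 3)" if "j < n" for i j
    using that by (simp add: G1_half_def) arith
  then show ?thesis
    using assms unfolding G1_arcs_def by auto
qed

lemma simple_arcs_G1: "n \<ge> 4 \<Longrightarrow> simple_arcs n (G1_arcs n)"
  unfolding simple_arcs_def G1_arcs_def G1_half_def
  by (auto simp: sym_def irrefl_def)

text \<open>Four arcs of a simple graph form two distinct edges, which share at most one vertex; the
  four ways of sharing one all give a path with middle vertex \<open>y\<close>.\<close>

lemma two_edges_cases [consumes 3]:
  assumes "card D = 4" "sym D" "irrefl D"
  obtains (disjoint) a b c d where "D = {(a, b), (b, a), (c, d), (d, c)}" "distinct [a, b, c, d]"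
    | (path) y v w where "D = {(y, v), (v, y), (y, w), (w, y)}" "distinct [y, v, w]"
proof -
  have fin: "finite D"
    using assms(1) by (metis card.infinite zero_neq_numeral)
  have flip: "(b, a) \<in> D" "a \<noteq> b" if "(a, b) \<in> D" for a b
    using that assms(2,3) by (auto dest: symD irreflD)
  obtain a b where ab: "(a, b) \<in> D"
    using assms(1) by (metis card.empty ex_in_conv surj_pair zero_neq_numeral)
  then have "card (D - {(a, b), (b, a)}) = 2"
    using fin flip[OF ab] assms(1) by (subst card_Diff_subset) auto
  then obtain c d where cd: "(c, d) \<in> D" "(c, d) \<noteq> (a, b)" "(c, d) \<noteq> (b, a)"
    by (metis (no_types, lifting) DiffD1 DiffD2 card.empty ex_in_conv insertCI surj_pair zero_neq_numeral)
  have "card {(a, b), (b, a), (c, d), (d, c)} = 4"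
    using cd flip[OF ab] flip[OF cd(1)] by auto
  then have D: "D = {(a, b), (b, a), (c, d), (d, c)}"
    using fin ab cd flip[OF ab] flip[OF cd(1)] assms(1) by (intro card_subset_eq[symmetric]) auto
  consider "distinct [a, b, c, d]" | "a = c" | "a = d" | "b = c" | "b = d"
    using flip(2)[OF ab] flip(2)[OF cd(1)] by auto
  then show ?thesis
  proof cases
    case 1
    then show ?thesis using D disjoint by blast
  next
    case 2
    then show ?thesis using D path[of a b d] cd flip(2)[OF ab] flip(2)[OF cd(1)] by auto
  next
    case 3
    then show ?thesis using D path[of a b c] cd flip(2)[OF ab] flip(2)[OF cd(1)] by auto
  next
    case 4
    then show ?thesis using D path[of b a d] cd flip(2)[OF ab] flip(2)[OF cd(1)] by auto
  next
    case 5
    then show ?thesis using D path[of b a c] cd flip(2)[OF ab] flip(2)[OF cd(1)] by auto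
  qed
qed

text \<open>Both sides have \<open>n - 4\<close> elements left over, and these may be matched
  arbitrarily: they will be the pendant vertices.\<close>

lemma exists_bij_first_four:
  assumes "distinct [x, y, v, w]" "{x, y, v, w} \<subseteq> {..<n}"
  obtains \<pi> where "bij_betw \<pi> {..<n :: nat} {..<n}" "\<pi> 0 = x" "\<pi> 1 = y" "\<pi> 2 = v" "\<pi> 3 = w"
proof -
  have card4: "card {x, y, v, w} = 4"
    using assms(1) by simp
  then have n: "n \<ge> 4"
    using card_mono[OF _ assms(2)] by simp
  have "card {4..<n} = card ({..<n} - {x, y, v, w})"
    using card4 assms(2) by (subst card_Diff_subset) auto
  then obtain h where h: "bij_betw h {4..<n} ({..<n} - {x, y, v, w})"
    using finite_same_card_bij[of "{4..<n}" "{..<n} - {x, y, v, w}"] by auto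
  define \<pi> where "\<pi> i = (if i = 0 then x else if i = 1 then y else if i = 2 then v else if i = 3 then w else h i)" for i
  have "bij_betw \<pi> {4..<n} ({..<n} - {x, y, v, w})"
    using h by (rule bij_betw_cong[THEN iffD1, rotated]) (auto simp: \<pi>_def)
  moreover have "bij_betw \<pi> {0, 1, 2, 3} {x, y, v, w}"
    using assms(1) by (auto simp: bij_betw_def inj_on_def \<pi>_def)
  ultimately have "bij_betw \<pi> ({4..<n} \<union> {0, 1, 2, 3}) (({..<n} - {x, y, v, w}) \<union> {x, y, v, w})"
    by (rule bij_betw_combine) auto
  moreover have "{4..<n} \<union> {0, 1, 2, 3} = {..<n}"
    using n by auto
  moreover have "({..<n} - {x, y, v, w}) \<union> {x, y, v, w} = {..<n}"
    using assms(2) by auto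
  ultimately have "bij_betw \<pi> {..<n} {..<n}"
    by simp
  then show ?thesis
    by (rule that) (simp_all add: \<pi>_def)
qed

lemma arcs_iso_G1_if_no_kelmans:
  assumes E: "bicyclic_arcs n E" and "n > 0" and no_kelmans: "\<And>u v. \<not> kelmans n E u v"
  shows "arcs_iso n E (G1_arcs n)"
proof -
  have simple: "simple_arcs n E" and conn: "connected_arcs n E" and card: "card E = 2 * (n + 1)"
    using E by (simp_all add: bicyclic_arcs_def)
  obtain x where x: "x < n" "\<And>y. y < n \<Longrightarrow> y \<noteq> x \<Longrightarrow> (x, y) \<in> E"
    using exists_dominating_vertex[OF simple conn \<open>n > 0\<close> no_kelmans] by blast
  have sym: "(b, a) \<in> E" if "(a, b) \<in> E" for a b
    using that simple by (auto simp: simple_arcs_def dest: symD)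
  have irr: "(a, a) \<notin> E" for a
    using simple by (auto simp: simple_arcs_def dest: irreflD)
  have lt: "a < n" "b < n" if "(a, b) \<in> E" for a b
    using that simple by (auto simp: simple_arcs_def)
  let ?V = "{..<n} - {x}"
  \<comment> \<open>The arcs avoiding the dominating vertex: \<open>2 * (n + 1)\<close> arcs in all,
    less \<open>2 * (n - 1)\<close> at \<open>x\<close>, leave 4.\<close>
  define D where "D = E \<inter> ?V \<times> ?V"
  have decomp: "E = D \<union> ({x} \<times> ?V \<union> ?V \<times> {x})"
  proof (intro Set.set_eqI, unfold split_paired_all)
    fix a b
    show "(a, b) \<in> E \<longleftrightarrow> (a, b) \<in> D \<union> ({x} \<times> ?V \<union> ?V \<times> {x})"
      using x(1) x(2)[of a] x(2)[of b] sym[of x a] irr[of x] lt[of a b] by (auto simp: D_def)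
  qed
  have "finite D"
    by (simp add: D_def)
  have "card E = card D + card ({x} \<times> ?V \<union> ?V \<times> {x})"
    by (subst decomp, rule card_Un_disjoint) (auto simp: D_def)
  also have "card ({x} \<times> ?V \<union> ?V \<times> {x}) = card ({x} \<times> ?V) + card (?V \<times> {x})"
    by (rule card_Un_disjoint) auto
  also have "\<dots> = 2 * (n - 1)"
    using x(1) by (simp add: card_cartesian_product)
  finally have "card D = 4"
    using card \<open>n > 0\<close> by simp
  moreover have "sym D" "irrefl D"
    using sym irr by (auto simp: D_def sym_def irrefl_def)
  ultimately obtain y v w where D: "D = {(y, v), (v, y), (y, w), (w, y)}" and dist: "distinct [y, v, w]"
  proof (cases rule: two_edges_cases)
    case (disjoint a b c d)
    then have abcd: "(a, b) \<in> D" "(c, d) \<in> D" "(a, d) \<notin> D" "(c, b) \<notin> D"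
      by auto
    \<comment> \<open>Disjoint edges \<open>ab\<close> and \<open>cd\<close> would allow a
      transformation of \<open>a\<close> and \<open>c\<close>: \<open>x\<close> is a common
      neighbour, while \<open>b\<close> and \<open>d\<close> are private ones.\<close>
    then have "(a, b) \<in> E" "(c, d) \<in> E" "(a, d) \<notin> E" "(c, b) \<notin> E" "(x, a) \<in> E" "(x, c) \<in> E"
      using x by (auto simp: D_def)
    moreover from this have "x \<in> E `` {a} \<inter> E `` {c}" "b \<in> E `` {a} - E `` {c} - {c}" "d \<in> E `` {c} - E `` {a} - {a}"
      using sym disjoint(2) by auto
    ultimately have "kelmans n E a c"
      unfolding kelmans_def using simple lt disjoint(2) by auto
    then show ?thesis
      using no_kelmans by blast
  next
    case (path y v w)
    then show ?thesis
      using that by blast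
  qed
  have "(y, v) \<in> D" "(w, y) \<in> D"
    using D by auto
  then have "distinct [x, y, v, w]" "{x, y, v, w} \<subseteq> {..<n}"
    using dist x(1) by (auto simp: D_def)
  then obtain \<pi> where bij: "bij_betw \<pi> {..<n} {..<n}" and \<pi>: "\<pi> 0 = x" "\<pi> 1 = y" "\<pi> 2 = v" "\<pi> 3 = w"
    by (rule exists_bij_first_four)
  have E_iff: "(p, q) \<in> E \<longleftrightarrow> p \<noteq> q \<and> (p = x \<or> q = x \<or> (p, q) \<in> {(y, v), (v, y), (y, w), (w, y)})"
    if "p < n" "q < n" for p q
  proof -
    have "(p, q) \<in> E \<longleftrightarrow> (p, q) \<in> D \<or> p = x \<and> q \<noteq> x \<or> p \<noteq> x \<and> q = x"
      using arg_cong[OF decomp, of "\<lambda>S. (p, q) \<in> S"] that x(1) by auto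
    then show ?thesis
      using \<open>distinct [x, y, v, w]\<close> unfolding D by auto
  qed
  have "card {x, y, v, w} \<le> card {..<n}"
    using \<open>{x, y, v, w} \<subseteq> {..<n}\<close> by (intro card_mono) auto
  then have n: "4 \<le> n"
    using \<open>distinct [x, y, v, w]\<close> by simp
  have eq_iff: "\<pi> i = \<pi> j \<longleftrightarrow> i = j" if "i < n" "j < n" for i j
    using that bij by (auto simp: bij_betw_def inj_on_eq_iff)
  have "(i, j) \<in> G1_arcs n \<longleftrightarrow> (\<pi> i, \<pi> j) \<in> E" if ij: "i < n" "j < n" for i j
  proof -
    have val: "\<pi> m = x \<longleftrightarrow> m = 0" "\<pi> m = y \<longleftrightarrow> m = 1" "\<pi> m = v \<longleftrightarrow> m = 2" "\<pi> m = w \<longleftrightarrow> m = 3"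
      if "m < n" for m
      using eq_iff[OF that, of 0] eq_iff[OF that, of 1] eq_iff[OF that, of 2] eq_iff[OF that, of 3] n \<pi>
      by simp_all
    have "\<pi> i < n" "\<pi> j < n"
      using ij bij by (auto dest: bij_betwE)
    then show ?thesis
      unfolding G1_arcs_iff[OF ij] E_iff[OF \<open>\<pi> i < n\<close> \<open>\<pi> j < n\<close>]
      by (simp add: val[OF ij(1)] val[OF ij(2)] eq_iff[OF ij])
  qed
  then have "arcs_iso n (G1_arcs n) E"
    using bij by (auto simp: arcs_iso_def)
  then show ?thesis
    by (rule arcs_iso_sym)
qed

section \<open>The extremal graph\<close>

text \<open>For weights that may vanish a transformation need not increase the radius strictly, so the sum
  of the squared degrees selects a graph to which no transformation applies.\<close>

theorem sradius_le_G1: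
  assumes E: "bicyclic_arcs n E" and n: "n \<ge> 4"
    and f: "symmetric_weight f" "property_P_star f" "nonneg_weight f"
  shows "sradius n (arc_weight f E) \<le> sradius n (arc_weight f (G1_arcs n))"
proof -
  define S where "S = {H. bicyclic_arcs n H \<and> sradius n (arc_weight f E) \<le> sradius n (arc_weight f H)}"
  have "S \<subseteq> Pow ({..<n} \<times> {..<n})"
    by (auto simp: S_def bicyclic_arcs_def simple_arcs_def)
  then have "finite S"
    by (rule finite_subset) simp
  have "E \<in> S"
    using E by (simp add: S_def)
  let ?m = "\<lambda>K. \<Sum>i<n. (deg K i)\<^sup>2"
  have "Max (?m ` S) \<in> ?m ` S"
    using \<open>finite S\<close> \<open>E \<in> S\<close> by (intro Max_in) auto
  then obtain H where H: "H \<in> S" and H_max: "?m H = Max (?m ` S)"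
    by auto
  have max: "?m K \<le> ?m H" if "K \<in> S" for K
    unfolding H_max using \<open>finite S\<close> that by (intro Max_ge) auto
  have "\<not> kelmans n H u v" for u v
  proof
    assume "kelmans n H u v"
    then obtain K where "bicyclic_arcs n K" "(\<Sum>i<n. (deg H i)\<^sup>2) < (\<Sum>i<n. (deg K i)\<^sup>2)"
      "sradius n (arc_weight f H) \<le> sradius n (arc_weight f K)"
      using kelmans_increases_sradius[of n H u v f] H f by (auto simp: S_def)
    then show False
      using H max[of K] by (auto simp: S_def)
  qed
  then have "arcs_iso n H (G1_arcs n)"
    using H n by (intro arcs_iso_G1_if_no_kelmans) (auto simp: S_def)
  then have "sradius n (arc_weight f H) = sradius n (arc_weight f (G1_arcs n))"
    using H f n simple_arcs_G1[OF n] by (intro sradius_eq_if_arcs_iso) (auto simp: S_def bicyclic_arcs_def)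
  then show ?thesis
    using H by (simp add: S_def)
qed

text \<open>With positive weights on \<open>E\<close> any transformation would strictly raise the
  radius, beyond the bound already shown for all bicyclic graphs.\<close>

theorem sradius_eq_G1_imp_arcs_iso:
  assumes E: "bicyclic_arcs n E" and n: "n \<ge> 4"
    and f: "symmetric_weight f" "property_P_star f" "nonneg_weight f"
    and pos: "\<And>i j. (i, j) \<in> E \<Longrightarrow> arc_weight f E i j > 0"
    and eq: "sradius n (arc_weight f E) = sradius n (arc_weight f (G1_arcs n))"
  shows "arcs_iso n E (G1_arcs n)"
proof (rule arcs_iso_G1_if_no_kelmans[OF E])
  show "\<not> kelmans n E u v" for u v
  proof
    assume "kelmans n E u v"
    then obtain K where "bicyclic_arcs n K" "sradius n (arc_weight f E) < sradius n (arc_weight f K)"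
      using kelmans_increases_sradius[OF E _ f] pos by metis
    then show False
      using sradius_le_G1[of n K f] n f eq by simp
  qed
qed (use n in simp)

section \<open>Translation between digraphs and arc relations\<close>

lemma deg_parcs: "degree_of G v = deg (parcs G) v"
proof -
  have "out_arcs (with_proj G) v = Pair v ` (parcs G `` {v})"
    by (auto simp: out_arcs_def)
  then show ?thesis
    by (simp add: degree_of_def out_degree_def deg_def card_image inj_on_def)
qed

lemma weighted_adj_mat_arc_weight:
  "spectral_radius_real (weighted_adj_mat f n G) = sradius n (arc_weight f (parcs G))"
  unfolding sradius_def weighted_adj_mat_def arc_weight_def deg_parcs ..

text \<open>The map from arcs to edges has fibres of size exactly two, by symmetry and
  irreflexivity.\<close>

lemma card_edges_of:
  assumes "finite (parcs G)" "sym (parcs G)" "irrefl (parcs G)"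
  shows "card (parcs G) = 2 * card (edges_of G)"
proof -
  have "(\<Sum>e\<in>edges_of G. card {a \<in> parcs G. (\<lambda>(u, v). {u, v}) a = e}) = card (parcs G)"
    using sum.image_gen[OF assms(1), of "\<lambda>_. 1 :: nat" "\<lambda>(u, v). {u, v}"] by (simp add: edges_of_def)
  moreover have "card {a \<in> parcs G. (\<lambda>(u, v). {u, v}) a = e} = 2" if e: "e \<in> edges_of G" for e
  proof -
    obtain u v where uv: "(u, v) \<in> parcs G" "e = {u, v}"
      using e by (auto simp: edges_of_def)
    then have "{a \<in> parcs G. (\<lambda>(u, v). {u, v}) a = e} = {(u, v), (v, u)}"
      using assms(2) by (auto simp: doubleton_eq_iff dest: symD)
    moreover have "u \<noteq> v"
      using uv assms(3) by (auto dest: irreflD)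
    ultimately show ?thesis
      by simp
  qed
  ultimately show ?thesis
    by simp
qed

lemma bicyclic_graph_imp_bicyclic_arcs:
  assumes "bicyclic_graph n G" "pverts G = {0..<n}"
  shows "bicyclic_arcs n (parcs G)"
proof -
  interpret pair_graph G
    using assms by (simp add: bicyclic_graph_def)
  have "parcs G \<subseteq> {..<n} \<times> {..<n}"
    using assms(2) in_arcsD1 in_arcsD2 by (auto simp: atLeast0LessThan)
  moreover have sym: "sym (parcs G)"
    by (auto intro: symI arcs_symmetric)
  moreover have irr: "irrefl (parcs G)"
    by (auto simp: irrefl_def dest: no_loops')
  ultimately have "simple_arcs n (parcs G)"
    by (simp add: simple_arcs_def)
  moreover have "connected_arcs n (parcs G)"
  proof -
    \<comment> \<open>Connectedness of a digraph refers to its symmetric closure, which here is the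
      arc relation itself.\<close>
    have "(parcs G)\<^sup>s = parcs G"
      using sym by (auto simp: symcl_def dest: symD)
    then have "(i, j) \<in> rtrancl_on {0..<n} (parcs G)" if "i < n" "j < n" for i j
      using assms that by (simp add: bicyclic_graph_def connected_conv)
    then show ?thesis
      unfolding connected_arcs_def by (blast intro: rtrancl_on_rtranclI)
  qed
  moreover have "card (parcs G) = 2 * (n + 1)"
    using assms card_edges_of[OF _ sym irr] by (simp add: bicyclic_graph_def)
  ultimately show ?thesis
    by (simp add: bicyclic_arcs_def)
qed

lemma parcs_G1: "parcs (G1 n) = G1_arcs n"
  by (simp add: G1_def G1_arcs_def)

text \<open>An isomorphism of digraphs also carries maps for arcs, heads and tails. Arcs here are
  pairs of vertices, so the vertex map determines the image arc relation.\<close>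

lemma graph_iso_G1_iff:
  assumes "pair_wf_digraph G" "pverts G = {0..<n}" "n \<ge> 4"
  shows "graph_iso G (G1 n) \<longleftrightarrow> arcs_iso n (parcs G) (G1_arcs n)"
proof
  interpret pair_wf_digraph G by fact
  have sub: "parcs G \<subseteq> {..<n} \<times> {..<n}"
    using assms(2) in_arcsD1 in_arcsD2 by (auto simp: atLeast0LessThan)
  {
    assume "graph_iso G (G1 n)"
    then obtain h where h: "digraph_isomorphism h" "with_proj (G1 n) = app_iso h (with_proj G)"
      by (auto simp: graph_iso_def digraph_iso_def)
    have inj: "inj_on (iso_verts h) {..<n}"
      using digraph_isomorphism_inj_on_verts[OF h(1)] assms(2) by (simp add: atLeast0LessThan)
    have "iso_verts h ` {..<n} = {..<n}"
      using arg_cong[OF h(2), of verts] assms(2) by (simp add: G1_def atLeast0LessThan)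
    moreover have arcs: "G1_arcs n = (\<lambda>(u, v). (iso_verts h u, iso_verts h v)) ` parcs G"
      using arg_cong[OF h(2), of arcs_ends] arcs_ends_app_iso_eq[OF h(1)] by (simp add: parcs_G1)
    moreover have "(i, j) \<in> parcs G \<longleftrightarrow> (iso_verts h i, iso_verts h j) \<in> G1_arcs n" if "i < n" "j < n" for i j
    proof
      assume "(iso_verts h i, iso_verts h j) \<in> G1_arcs n"
      then obtain i' j' where "(i', j') \<in> parcs G" "iso_verts h i = iso_verts h i'" "iso_verts h j = iso_verts h j'"
        unfolding arcs by auto
      moreover from this have "i' < n" "j' < n"
        using sub by auto
      ultimately show "(i, j) \<in> parcs G"
        using that inj by (metis inj_onD lessThan_iff)
    qed (auto simp: arcs)
    ultimately show "arcs_iso n (parcs G) (G1_arcs n)"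
      using inj unfolding arcs_iso_def bij_betw_def by blast
  next
    assume "arcs_iso n (parcs G) (G1_arcs n)"
    then obtain \<pi> where bij: "bij_betw \<pi> {..<n} {..<n}"
      and \<pi>: "\<And>i j. i < n \<Longrightarrow> j < n \<Longrightarrow> (i, j) \<in> parcs G \<longleftrightarrow> (\<pi> i, \<pi> j) \<in> G1_arcs n"
      by (auto simp: arcs_iso_def)
    let ?h = "\<lparr>iso_verts = \<pi>, iso_arcs = map_prod \<pi> \<pi>, iso_head = snd, iso_tail = fst\<rparr>"
    have inj: "inj_on \<pi> {..<n}" and im: "\<pi> ` {..<n} = {..<n}"
      using bij by (auto simp: bij_betw_def)
    have "inj_on (map_prod \<pi> \<pi>) (parcs G)"
      by (rule inj_on_subset[OF map_prod_inj_on[OF inj inj] sub])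
    then have "digraph_isomorphism ?h"
      unfolding digraph_isomorphism_def using inj assms(2)
      by (auto simp: atLeast0LessThan wf_digraph_wp_iff assms(1))
    moreover have "map_prod \<pi> \<pi> ` parcs G = G1_arcs n"
    proof (intro equalityI subsetI)
      fix e assume "e \<in> G1_arcs n"
      then obtain a b where e: "e = (a, b)" "(a, b) \<in> G1_arcs n" "a \<in> \<pi> ` {..<n}" "b \<in> \<pi> ` {..<n}"
        using simple_arcs_G1[OF assms(3)] im by (cases e) (auto simp: simple_arcs_def)
      then show "e \<in> map_prod \<pi> \<pi> ` parcs G"
        using \<pi> by (auto simp: image_iff) (metis (no_types, lifting) lessThan_iff map_prod_simp)
    qed (use \<pi> sub in auto)
    then have "with_proj (G1 n) = app_iso ?h (with_proj G)"
      using im assms(2) by (simp add: with_proj_def app_iso_def parcs_G1 atLeast0LessThan) (simp add: G1_def atLeast0LessThan)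
    ultimately show "graph_iso G (G1 n)"
      unfolding graph_iso_def digraph_iso_def by blast
  }
qed

text \<open>Weights that are positive on the edges of a graph may be negative on the edges of its
  transforms, since degrees can drop. Replacing negative values by zero preserves property
  \<open>P*\<close> and does not change the two matrices in the theorem.\<close>

definition truncated_weight :: "(real \<Rightarrow> real \<Rightarrow> real) \<Rightarrow> real \<Rightarrow> real \<Rightarrow> real" where
  "truncated_weight f x y = max (f x y) 0"

lemma nonneg_truncated_weight: "nonneg_weight (truncated_weight f)"
  by (simp add: nonneg_weight_def truncated_weight_def)

lemma symmetric_truncated_weight: "symmetric_weight f \<Longrightarrow> symmetric_weight (truncated_weight f)"
  by (simp add: symmetric_weight_def truncated_weight_def)

lemma convex_on_max:
  fixes g h :: "'a :: real_vector \<Rightarrow> real"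
  assumes "convex_on S g" "convex_on S h"
  shows "convex_on S (\<lambda>x. max (g x) (h x))"
proof (rule convex_onI)
  fix t :: real and x y assume t: "0 < t" "t < 1" and xy: "x \<in> S" "y \<in> S"
  have "g ((1 - t) *\<^sub>R x + t *\<^sub>R y) \<le> (1 - t) * g x + t * g y"
    "h ((1 - t) *\<^sub>R x + t *\<^sub>R y) \<le> (1 - t) * h x + t * h y"
    using assms t xy by (auto intro!: convex_onD)
  moreover have "(1 - t) * g x + t * g y \<le> (1 - t) * max (g x) (h x) + t * max (g y) (h y)"
    "(1 - t) * h x + t * h y \<le> (1 - t) * max (g x) (h x) + t * max (g y) (h y)"
    using t by (auto intro!: add_mono mult_left_mono)
  ultimately show "max (g ((1 - t) *\<^sub>R x + t *\<^sub>R y)) (h ((1 - t) *\<^sub>R x + t *\<^sub>R y))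
      \<le> (1 - t) * max (g x) (h x) + t * max (g y) (h y)"
    by simp
qed (use assms convex_on_imp_convex in blast)

lemma property_P_star_truncated_weight:
  assumes "property_P_star f"
  shows "property_P_star (truncated_weight f)"
proof -
  have "mono_on {1..} (\<lambda>x. max (f x y) 0)" "convex_on {1..} (\<lambda>x. max (f x y) 0)" if "y \<ge> 1" for y
    using assms that unfolding property_P_star_def
    by (auto intro!: convex_on_max mono_onI max.mono dest: mono_onD simp: convex_on_const)
  moreover have "max (f x1 y1) 0 \<ge> max (f x2 y2) 0"
    if "x1 \<ge> 1" "y1 \<ge> 1" "x2 \<ge> 1" "y2 \<ge> 1" "\<bar>x1 - y1\<bar> > \<bar>x2 - y2\<bar>" "x1 + y1 = x2 + y2" for x1 y1 x2 y2
    using assms that unfolding property_P_star_def by (intro max.mono) auto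
  ultimately show ?thesis
    unfolding property_P_star_def truncated_weight_def by blast
qed

lemma arc_weight_truncated:
  assumes "positive_on_edges f G"
  shows "arc_weight (truncated_weight f) (parcs G) = arc_weight f (parcs G)"
  using assms by (auto simp: fun_eq_iff arc_weight_def truncated_weight_def positive_on_edges_def deg_parcs
      split: prod.splits)

theorem theorem2p1:
  fixes n :: nat
    and f :: "real \<Rightarrow> real \<Rightarrow> real"
    and G :: "nat pair_pre_digraph"
  assumes "n \<ge> 4"
    and "symmetric_weight f"
    and "property_P_star f"
    and "pverts G = {0..<n}"
    and "bicyclic_graph n G"
    and "positive_on_edges f G"
    and "positive_on_edges f (G1 n)"
  shows "spectral_radius_real (weighted_adj_mat f n G)
           \<le> spectral_radius_real (weighted_adj_mat f n (G1 n))
         \<and> (spectral_radius_real (weighted_adj_mat f n G)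
              = spectral_radius_real (weighted_adj_mat f n (G1 n))
            \<longleftrightarrow> graph_iso G (G1 n))"
proof -
  \<comment> \<open>The transformations need a weight that is nonnegative at every degree pair; on
    the edges of \<open>G\<close> and \<open>G1 n\<close> it coincides with
    \<open>f\<close>.\<close>
  let ?g = "truncated_weight f"
  note g = symmetric_truncated_weight[OF assms(2)] property_P_star_truncated_weight[OF assms(3)]
    nonneg_truncated_weight[of f]
  have G: "bicyclic_arcs n (parcs G)"
    using assms by (intro bicyclic_graph_imp_bicyclic_arcs)
  have "pair_wf_digraph G"
    using assms(5) by (auto simp: bicyclic_graph_def pair_graph_def pair_digraph_def pair_fin_digraph_def)
  then have iso: "graph_iso G (G1 n) \<longleftrightarrow> arcs_iso n (parcs G) (G1_arcs n)"
    using assms by (intro graph_iso_G1_iff)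
  have rad: "spectral_radius_real (weighted_adj_mat f n G) = sradius n (arc_weight ?g (parcs G))"
    "spectral_radius_real (weighted_adj_mat f n (G1 n)) = sradius n (arc_weight ?g (G1_arcs n))"
    using arc_weight_truncated[OF assms(6)] arc_weight_truncated[OF assms(7)]
    by (simp_all add: weighted_adj_mat_arc_weight parcs_G1)
  have "arc_weight ?g (parcs G) i j > 0" if "(i, j) \<in> parcs G" for i j
    unfolding arc_weight_truncated[OF assms(6)]
    using that assms(6) by (auto simp: arc_weight_def positive_on_edges_def deg_parcs)
  then show ?thesis
    unfolding rad iso
    using sradius_le_G1[OF G assms(1) g] sradius_eq_G1_imp_arcs_iso[OF G assms(1) g]
      sradius_eq_if_arcs_iso[of n "parcs G" "G1_arcs n" ?g] G g assms(1) simple_arcs_G1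
    by (auto simp: bicyclic_arcs_def)
qed

end
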